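(* Let $1\le q<+\infty$, let $(\Omega,\mathcal A,\mu)$ be a $\sigma$-finite separable measure space, with diffuse part $\Omega_d$, and let $u\in L^q(\mu)$. Let $M_u:L^\infty(\mu)\to L^q(\mu)$, $f\mapsto uf$. Then $$\tfrac12\|u_{|\Omega_d}\|_q\le\|M_u\|_{e,\infty\to q}\le\|u_{|\Omega_d}\|_q.$$
   Context: A $\sigma$-finite measure space $(\Omega,\mathcal A,\mu)$ can be decomposed as a disjoint union $\Omega=\Omega_d\cup\Omega_a$ with $\Omega_d,\Omega_a\in\mathcal A$, where the restriction $\mu_d$ of $\mu$ to $\Omega_d$ is diffuse (for any measurable $A\subset\Omega_d$ with $\mu_d(A)>0$ and any $\alpha\in(0,\mu_d(A))$ there is $A'\in\mathcal A$, $A'\subset A$, with $\mu_d(A')=\alpha$) and the restriction $\mu_a$ of $\mu$ to $\Omega_a$ is purely atomic ($\Omega_a$ is the disjoint union of a finite or infinite, possibly empty, sequence $(A_n)$ of atoms, i.e. every measurable subset of $A_n$ has measure $0$ or $\mu_a(A_n)$). The measure space is called separable if there exists a sequence $(B_n)\subset\mathcal A$ such that for any $B\in\mathcal A$ and any $\varepsilon>0$ there is $n\ge1$ with $\mu(B\Delta B_n)<\varepsilon$. $L^q(\mu)$ denotes complex-valued functions. $\|u_{|\Omega_d}\|_q=\left(\int_{\Omega_d}|u|^q\,d\mu\right)^{1/q}$. The essential norm $\|T\|_{e,\infty\to q}$ of a bounded operator $T:L^\infty(\mu)\to L^q(\mu)$ is $\inf\{\|T-K\|:\ K:L^\infty(\mu)\to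 L^q(\mu)\text{ compact}\}$. *)

theory Defs
  imports "HOL-Analysis.Analysis" "HOL-Probability.Essential_Supremum"
begin

definition separable_measure :: "'a measure \<Rightarrow> bool" where
  "separable_measure M \<longleftrightarrow>
     (\<exists>B :: nat \<Rightarrow> 'a set. range B \<subseteq> sets M \<and>
        (\<forall>A\<in>sets M. \<forall>\<epsilon>::real. \<epsilon> > 0 \<longrightarrow>
           (\<exists>n. emeasure M (sym_diff A (B n)) < ennreal \<epsilon>)))"

text \<open>The value \<open>\<alpha>\<close> is automatically finite, whereas \<open>emeasure M A\<close> may be infinite.\<close>

definition diffuse_measure :: "'a measure \<Rightarrow> bool" where
  "diffuse_measure M \<longleftrightarrow>
     (\<forall>A\<in>sets M. \<forall>\<alpha>::ennreal. 0 < \<alpha> \<and> \<alpha> < emeasure M A \<longrightarrow>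
        (\<exists>A'\<in>sets M. A' \<subseteq> A \<and> emeasure M A' = \<alpha>))"

text \<open>No positivity of the measure of an atom is required, so null sets count as atoms.\<close>

definition measure_atom :: "'a measure \<Rightarrow> 'a set \<Rightarrow> bool" where
  "measure_atom M A \<longleftrightarrow> A \<in> sets M \<and>
     (\<forall>B\<in>sets M. B \<subseteq> A \<longrightarrow> emeasure M B = 0 \<or> emeasure M B = emeasure M A)"

definition purely_atomic_measure :: "'a measure \<Rightarrow> bool" where
  "purely_atomic_measure M \<longleftrightarrow>
     (\<exists>\<A>. countable \<A> \<and> disjoint \<A> \<and> (\<forall>A\<in>\<A>. measure_atom M A) \<and> \<Union>\<A> = space M)"

definition diffuse_atomic_decomposition :: "'a measure \<Rightarrow> 'a set \<Rightarrow> 'a set \<Rightarrow> bool" where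
  "diffuse_atomic_decomposition M D A \<longleftrightarrow>
     D \<in> sets M \<and> A \<in> sets M \<and> D \<inter> A = {} \<and> D \<union> A = space M \<and>
     diffuse_measure (restrict_space M D) \<and> purely_atomic_measure (restrict_space M A)"

text \<open>Elements of the Lebesgue spaces are represented by measurable functions; functions that
  agree almost everywhere are at distance \<open>0\<close> for the seminorms below.\<close>

definition Lq :: "real \<Rightarrow> 'a measure \<Rightarrow> ('a \<Rightarrow> complex) set" where
  "Lq q M = {f \<in> borel_measurable M. integrable M (\<lambda>x. cmod (f x) powr q)}"

definition Lq_norm :: "real \<Rightarrow> 'a measure \<Rightarrow> ('a \<Rightarrow> complex) \<Rightarrow> real" where
  "Lq_norm q M f = (LINT x|M. cmod (f x) powr q) powr (1 / q)"

definition Linf :: "'a measure \<Rightarrow> ('a \<Rightarrow> complex) set" where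
  "Linf M = {f \<in> borel_measurable M. esssup M (\<lambda>x. ereal (cmod (f x))) < \<infinity>}"

text \<open>If \<open>M\<close> is the zero measure, the essential supremum is \<open>-\<infinity>\<close>, which
  \<open>real_of_ereal\<close> maps to \<open>0\<close>.\<close>

definition Linf_norm :: "'a measure \<Rightarrow> ('a \<Rightarrow> complex) \<Rightarrow> real" where
  "Linf_norm M f = real_of_ereal (esssup M (\<lambda>x. ereal (cmod (f x))))"

text \<open>Bounded linear operators from \<open>L\<^sup>\<infinity>\<close> to \<open>L\<^sup>q\<close> act on representatives and are linear up to
  null sets. Linearity and the norm bound together make such a map respect equality almost
  everywhere, so it induces an operator on equivalence classes, and every operator on equivalence
  classes arises in this way. Values outside \<open>Linf M\<close> are irrelevant.\<close>

definition bounded_operator ::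
    "real \<Rightarrow> 'a measure \<Rightarrow> (('a \<Rightarrow> complex) \<Rightarrow> ('a \<Rightarrow> complex)) \<Rightarrow> bool" where
  "bounded_operator q M T \<longleftrightarrow>
     (\<forall>f\<in>Linf M. T f \<in> Lq q M) \<and>
     (\<forall>f\<in>Linf M. \<forall>g\<in>Linf M. \<forall>a b :: complex.
        AE x in M. T (\<lambda>y. a * f y + b * g y) x = a * T f x + b * T g x) \<and>
     (\<exists>C. \<forall>f\<in>Linf M. Lq_norm q M (T f) \<le> C * Linf_norm M f)"

definition compact_operator ::
    "real \<Rightarrow> 'a measure \<Rightarrow> (('a \<Rightarrow> complex) \<Rightarrow> ('a \<Rightarrow> complex)) \<Rightarrow> bool" where
  "compact_operator q M T \<longleftrightarrow> bounded_operator q M T \<and>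
     (\<forall>f :: nat \<Rightarrow> 'a \<Rightarrow> complex.
        (\<forall>n. f n \<in> Linf M) \<and> (\<exists>C. \<forall>n. Linf_norm M (f n) \<le> C) \<longrightarrow>
        (\<exists>g\<in>Lq q M. \<exists>r :: nat \<Rightarrow> nat. strict_mono r \<and>
           (\<lambda>n. Lq_norm q M (\<lambda>x. T (f (r n)) x - g x)) \<longlonglongrightarrow> 0))"

definition operator_norm ::
    "real \<Rightarrow> 'a measure \<Rightarrow> (('a \<Rightarrow> complex) \<Rightarrow> ('a \<Rightarrow> complex)) \<Rightarrow> real" where
  "operator_norm q M T = (SUP f\<in>{f \<in> Linf M. Linf_norm M f \<le> 1}. Lq_norm q M (T f))"

definition essential_norm ::
    "real \<Rightarrow> 'a measure \<Rightarrow> (('a \<Rightarrow> complex) \<Rightarrow> ('a \<Rightarrow> complex)) \<Rightarrow> real" where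
  "essential_norm q M T =
     (INF K\<in>{K. compact_operator q M K}. operator_norm q M (\<lambda>f x. T f x - K f x))"

definition multiplication_operator ::
    "('a \<Rightarrow> complex) \<Rightarrow> ('a \<Rightarrow> complex) \<Rightarrow> ('a \<Rightarrow> complex)" where
  "multiplication_operator u f = (\<lambda>x. u x * f x)"

end

theory Submission
  imports Defs
begin

text \<open>
  Upper bound: multiplication by \<open>u\<close> restricted to the atomic part is compact, because a bounded
  sequence in \<open>L\<^sup>\<infinity>\<close> is almost everywhere constant on each of the countably many atoms, so a
  subsequence converges pointwise there and dominated convergence applies.

  Lower bound: for a nonnegative simple function \<open>s \<le> |u|\<^sup>q\<close> supported on the diffuse part,
  repeated halving gives sets \<open>E\<^sub>n\<close> such that \<open>E\<^sub>m \<triangle> E\<^sub>n\<close> carries half of the measure \<open>s \<mu>\<close>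
  whenever \<open>m \<noteq> n\<close>. If \<open>K\<close> is compact, \<open>K 1\<^bsub>E\<^sub>m\<^esub>\<close> and \<open>K 1\<^bsub>E\<^sub>n\<^esub>\<close> are arbitrarily close for
  suitable \<open>m \<noteq> n\<close>, so testing \<open>M\<^sub>u - K\<close> on \<open>1\<^bsub>E\<^sub>m\<^esub> - 1\<^bsub>E\<^sub>n\<^esub>\<close>, of norm at most \<open>1\<close>, gives
  \<open>\<parallel>M\<^sub>u - K\<parallel>\<^sup>q \<ge> \<integral> s d\<mu> / 2\<close>. This even yields the factor \<open>2\<close> to the power \<open>-1/q\<close> in place of \<open>1/2\<close>.
\<close>

section \<open>Convexity of powers, Minkowski's inequality and essential bounds\<close>

section \<open>The seminorms\<close>

text \<open>For positive \<open>s\<close> and \<open>t\<close> this is convexity of the power on the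
  open half line; if one of them vanishes, it reduces to \<open>c powr q \<le> c\<close> for
  \<open>0 < c < 1\<close>.\<close>

lemma powr_convex_combination:
  fixes s t l q :: real
  assumes q: "1 \<le> q" and st: "0 \<le> s" "0 \<le> t" and l: "0 < l" "l < 1"
  shows "(l * s + (1 - l) * t) powr q \<le> l * s powr q + (1 - l) * t powr q"
proof -
  have shrink: "(c * r) powr q \<le> c * r powr q" if "0 < c" "c < 1" "0 \<le> r" for c r :: real
  proof -
    have "c powr q \<le> c powr 1"
      using that q by (intro powr_mono') auto
    then show ?thesis
      using that by (simp add: powr_mult mult_right_mono)
  qed
  show ?thesis
  proof (cases "s = 0 \<or> t = 0")
    case True
    then show ?thesis
      using shrink[of l s] shrink[of "1 - l" t] l st q by auto
  next
    case False
    then have "s > 0" "t > 0" using st by auto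
    then show ?thesis
      using convex_onD[OF powr_convex[OF q], of "1 - l" s t] l by auto
  qed
qed

lemma Lq_norm_nonneg: "0 \<le> Lq_norm q M f"
  by (simp add: Lq_norm_def)

lemma Lq_norm_powr:
  assumes "1 \<le> q"
  shows "Lq_norm q M f powr q = (LINT x|M. cmod (f x) powr q)"
  using assms by (simp add: Lq_norm_def powr_powr)

lemma Lq_norm_cong_AE:
  assumes [measurable]: "f \<in> borel_measurable M" "g \<in> borel_measurable M"
    and "AE x in M. f x = g x"
  shows "Lq_norm q M f = Lq_norm q M g"
proof -
  have "(LINT x|M. cmod (f x) powr q) = (LINT x|M. cmod (g x) powr q)"
    using assms(3) by (intro integral_cong_AE) auto
  then show ?thesis by (simp add: Lq_norm_def)
qed

text \<open>Monotonicity of the power turns pointwise domination into domination of the integrands.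
  Membership and norm bounds for scalar multiples, products with essentially bounded functions and
  restrictions of \<open>u\<close> all come from here.\<close>

lemma Lq_bounded_AE:
  assumes f: "f \<in> Lq q M" and [measurable]: "g \<in> borel_measurable M"
    and le: "AE x in M. cmod (g x) \<le> C * cmod (f x)" and q: "1 \<le> q" and C: "0 \<le> C"
  shows "g \<in> Lq q M" and "Lq_norm q M g \<le> C * Lq_norm q M f"
proof -
  have [measurable]: "f \<in> borel_measurable M"
    and int: "integrable M (\<lambda>x. cmod (f x) powr q)"
    using f by (auto simp: Lq_def)
  have le': "AE x in M. cmod (g x) powr q \<le> C powr q * cmod (f x) powr q"
    using le
  proof eventually_elim
    case (elim x)
    then have "cmod (g x) powr q \<le> (C * cmod (f x)) powr q"
      using q by (intro powr_mono2) auto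
    then show ?case using C by (simp add: powr_mult)
  qed
  have int_g: "integrable M (\<lambda>x. cmod (g x) powr q)"
    by (rule Bochner_Integration.integrable_bound[of M "\<lambda>x. C powr q * cmod (f x) powr q"])
      (use int le' in auto)
  then show "g \<in> Lq q M" by (simp add: Lq_def)
  have "(LINT x|M. cmod (g x) powr q) \<le> (LINT x|M. C powr q * cmod (f x) powr q)"
    using int_g int le' by (intro integral_mono_AE) auto
  then have "Lq_norm q M g \<le> (C powr q * (LINT x|M. cmod (f x) powr q)) powr (1 / q)"
    unfolding Lq_norm_def using q by (intro powr_mono2) (auto intro: integral_nonneg_AE)
  also have "\<dots> = C * Lq_norm q M f"
    using q C by (simp add: Lq_norm_def powr_mult powr_powr integral_nonneg_AE)
  finally show "Lq_norm q M g \<le> C * Lq_norm q M f" .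
qed

text \<open>The sum of the moduli is \<open>a + b\<close> times a convex combination of
  \<open>cmod (f x) / a\<close> and \<open>cmod (g x) / b\<close>, where \<open>a\<close> and
  \<open>b\<close> bound the two norms; integrating the convexity inequality gives the
  claim.\<close>

lemma Lq_norm_minkowski:
  assumes q: "1 \<le> q" and f: "f \<in> Lq q M" and g: "g \<in> Lq q M"
  shows "(\<lambda>x. f x + g x) \<in> Lq q M"
    and "Lq_norm q M (\<lambda>x. f x + g x) \<le> Lq_norm q M f + Lq_norm q M g"
proof -
  have [measurable]: "f \<in> borel_measurable M" "g \<in> borel_measurable M"
    and int: "integrable M (\<lambda>x. cmod (f x) powr q)" "integrable M (\<lambda>x. cmod (g x) powr q)"
    using f g by (auto simp: Lq_def)
  \<comment> \<open>Strictly positive bounds \<open>a\<close> and \<open>b\<close> stand in for the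
    norms, so that division is possible even when a norm vanishes; the excess tends to
    \<open>0\<close> at the end.\<close>
  have *: "integrable M (\<lambda>x. cmod (f x + g x) powr q)
      \<and> (LINT x|M. cmod (f x + g x) powr q) \<le> (a + b) powr q"
    if ab: "a > 0" "b > 0" "Lq_norm q M f \<le> a" "Lq_norm q M g \<le> b" for a b
  proof -
    define l where "l = a / (a + b)"
    have l: "0 < l" "l < 1" and l': "1 - l = b / (a + b)"
      using ab by (auto simp: l_def field_simps)
    let ?h = "\<lambda>x. (a + b) powr q * (l * (cmod (f x) powr q / a powr q)
                     + (1 - l) * (cmod (g x) powr q / b powr q))"
    have le: "cmod (f x + g x) powr q \<le> ?h x" for x
    proof -
      have "cmod (f x) + cmod (g x) = (a + b) * (l * (cmod (f x) / a) + (1 - l) * (cmod (g x) / b))"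
      proof -
        have "(a + b) * (l * r + (1 - l) * t) = a * r + b * t" for r t
          unfolding l' using ab by (simp add: l_def distrib_left)
        from this[of "cmod (f x) / a" "cmod (g x) / b"] show ?thesis using ab by simp
      qed
      then have "cmod (f x + g x) powr q
          \<le> ((a + b) * (l * (cmod (f x) / a) + (1 - l) * (cmod (g x) / b))) powr q"
        using q norm_triangle_ineq[of "f x" "g x"] by (intro powr_mono2) auto
      also have "\<dots> = (a + b) powr q * (l * (cmod (f x) / a) + (1 - l) * (cmod (g x) / b)) powr q"
        by (rule powr_mult)
      also have "\<dots> \<le> ?h x"
        using powr_convex_combination[OF q _ _ l, of "cmod (f x) / a" "cmod (g x) / b"] ab
        by (intro mult_left_mono) (auto simp: powr_divide)
      finally show ?thesis .
    qed
    have int_h: "integrable M ?h"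
      using int by auto
    have int': "integrable M (\<lambda>x. cmod (f x + g x) powr q)"
      by (rule Bochner_Integration.integrable_bound[OF int_h])
        (use le in \<open>auto intro!: AE_I2 order_trans[OF _ abs_ge_self]\<close>)
    have bnd: "(LINT x|M. cmod (f x) powr q) / a powr q \<le> 1"
      "(LINT x|M. cmod (g x) powr q) / b powr q \<le> 1"
      using powr_mono2[OF _ Lq_norm_nonneg ab(3), of q] powr_mono2[OF _ Lq_norm_nonneg ab(4), of q]
        ab q by (auto simp: Lq_norm_powr field_simps)
    have "(LINT x|M. cmod (f x + g x) powr q) \<le> (LINT x|M. ?h x)"
      by (intro integral_mono int_h int' le)
    also have "\<dots> = (a + b) powr q * (l * ((LINT x|M. cmod (f x) powr q) / a powr q)
                     + (1 - l) * ((LINT x|M. cmod (g x) powr q) / b powr q))"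
      using int by simp
    also have "\<dots> \<le> (a + b) powr q * (l * 1 + (1 - l) * 1)"
      using bnd l by (intro mult_left_mono add_mono) auto
    finally show ?thesis using int' by simp
  qed
  have pos: "Lq_norm q M f + e > 0" "Lq_norm q M g + e > 0" if "e > 0" for e
    using that Lq_norm_nonneg[of q M f] Lq_norm_nonneg[of q M g] by auto
  show "(\<lambda>x. f x + g x) \<in> Lq q M"
    using *[OF pos[of 1]] by (simp add: Lq_def)
  show "Lq_norm q M (\<lambda>x. f x + g x) \<le> Lq_norm q M f + Lq_norm q M g"
  proof (rule field_le_epsilon)
    fix e :: real assume "e > 0"
    then have "(LINT x|M. cmod (f x + g x) powr q)
        \<le> ((Lq_norm q M f + e / 2) + (Lq_norm q M g + e / 2)) powr q"
      using *[OF pos[of "e / 2"]] by simp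
    then have "Lq_norm q M (\<lambda>x. f x + g x)
        \<le> (((Lq_norm q M f + e / 2) + (Lq_norm q M g + e / 2)) powr q) powr (1 / q)"
      unfolding Lq_norm_def[of q M "\<lambda>x. f x + g x"]
      using q by (intro powr_mono2) (auto intro: integral_nonneg_AE)
    also have "\<dots> = Lq_norm q M f + Lq_norm q M g + e"
      using q \<open>e > 0\<close> Lq_norm_nonneg[of q M f] Lq_norm_nonneg[of q M g]
      by (simp add: powr_powr)
    finally show "Lq_norm q M (\<lambda>x. f x + g x) \<le> Lq_norm q M f + Lq_norm q M g + e" .
  qed
qed

lemma Lq_cmult:
  assumes "1 \<le> q" "f \<in> Lq q M"
  shows "(\<lambda>x. c * f x) \<in> Lq q M" and "Lq_norm q M (\<lambda>x. c * f x) \<le> cmod c * Lq_norm q M f"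
proof -
  have [measurable]: "f \<in> borel_measurable M" using assms by (simp add: Lq_def)
  have "AE x in M. cmod (c * f x) \<le> cmod c * cmod (f x)" by (simp add: norm_mult)
  then show "(\<lambda>x. c * f x) \<in> Lq q M" "Lq_norm q M (\<lambda>x. c * f x) \<le> cmod c * Lq_norm q M f"
    using Lq_bounded_AE[OF assms(2), of "\<lambda>x. c * f x" "cmod c"] assms(1) by auto
qed

lemma Lq_diff:
  assumes "1 \<le> q" "f \<in> Lq q M" "g \<in> Lq q M"
  shows "(\<lambda>x. f x - g x) \<in> Lq q M"
    and "Lq_norm q M (\<lambda>x. f x - g x) \<le> Lq_norm q M f + Lq_norm q M g"
  using Lq_norm_minkowski[OF assms(1,2) Lq_cmult(1)[OF assms(1,3), of "-1"]]
    Lq_cmult(2)[OF assms(1,3), of "-1"] by auto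

lemma Linf_AE_bound:
  assumes "f \<in> Linf M"
  shows "AE x in M. cmod (f x) \<le> Linf_norm M f"
proof -
  have *: "AE x in M. ereal (cmod (f x)) \<le> esssup M (\<lambda>x. ereal (cmod (f x)))"
    by (rule esssup_AE)
  have fin: "esssup M (\<lambda>x. ereal (cmod (f x))) < \<infinity>"
    using assms by (simp add: Linf_def)
  show ?thesis
    using *
  proof eventually_elim
    case (elim x)
    then show ?case using fin unfolding Linf_norm_def
      by (cases "esssup M (\<lambda>x. ereal (cmod (f x)))") auto
  qed
qed

text \<open>On a nonzero measure, a negative norm would bound a modulus almost everywhere. On the
  zero measure the essential supremum \<open>-\<infinity>\<close> has real value
  \<open>0\<close>.\<close>

lemma Linf_norm_nonneg:
  assumes "f \<in> Linf M"
  shows "0 \<le> Linf_norm M f"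
proof (cases "emeasure M (space M) = 0")
  case True
  have [measurable]: "f \<in> borel_measurable M" using assms by (simp add: Linf_def)
  have "esssup M (\<lambda>x. ereal (cmod (f x))) = -\<infinity>"
    using True by (simp add: esssup_def ae_filter_eq_bot_iff[THEN iffD2] bot_ereal_def)
  then show ?thesis by (simp add: Linf_norm_def)
next
  case False
  show ?thesis
  proof (rule ccontr)
    assume "\<not> 0 \<le> Linf_norm M f"
    then have "AE x in M. False"
      using Linf_AE_bound[OF assms] by (auto elim!: eventually_mono dest: order_trans[OF norm_ge_zero])
    then show False using False by (simp add: AE_iff_measurable[OF sets.top])
  qed
qed

lemma LinfI:
  assumes [measurable]: "f \<in> borel_measurable M"
    and "AE x in M. cmod (f x) \<le> C" "0 \<le> C"
  shows "f \<in> Linf M" and "Linf_norm M f \<le> C"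
proof -
  have "esssup M (\<lambda>x. ereal (cmod (f x))) \<le> ereal C"
    using assms(2) by (intro esssup_I) auto
  \<comment> \<open>The essential supremum may be \<open>-\<infinity>\<close>; the norm is then
    \<open>0\<close>, and \<open>0 \<le> C\<close> gives the bound.\<close>
  then show "f \<in> Linf M" "Linf_norm M f \<le> C"
    using \<open>0 \<le> C\<close> unfolding Linf_def Linf_norm_def
    by (auto intro: le_less_trans, cases "esssup M (\<lambda>x. ereal (cmod (f x)))", auto)
qed

section \<open>Multiplication by an \<open>Lq\<close> function, and operator norms as real
  suprema\<close>

section \<open>Operators\<close>

lemma multiplication_operator_Lq:
  assumes q: "1 \<le> q" and w: "w \<in> Lq q M" and f: "f \<in> Linf M"
  shows "multiplication_operator w f \<in> Lq q M"
    and "Lq_norm q M (multiplication_operator w f) \<le> Linf_norm M f * Lq_norm q M w"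
proof -
  have [measurable]: "w \<in> borel_measurable M" "f \<in> borel_measurable M"
    using w f by (auto simp: Lq_def Linf_def)
  have [measurable]: "multiplication_operator w f \<in> borel_measurable M"
    by (simp add: multiplication_operator_def)
  have "AE x in M. cmod (multiplication_operator w f x) \<le> Linf_norm M f * cmod (w x)"
    using Linf_AE_bound[OF f]
    by eventually_elim (auto simp: multiplication_operator_def norm_mult mult.commute mult_right_mono)
  then show "multiplication_operator w f \<in> Lq q M"
    "Lq_norm q M (multiplication_operator w f) \<le> Linf_norm M f * Lq_norm q M w"
    using Lq_bounded_AE[OF w, of "multiplication_operator w f" "Linf_norm M f"] q Linf_norm_nonneg[OF f]
    by auto
qed

lemma bounded_multiplication_operator:
  assumes "1 \<le> q" "w \<in> Lq q M"
  shows "bounded_operator q M (multiplication_operator w)"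
  unfolding bounded_operator_def
  using multiplication_operator_Lq[OF assms]
  by (auto simp: multiplication_operator_def algebra_simps intro!: exI[of _ "Lq_norm q M w"])

lemma operator_norm_le:
  assumes "\<And>f. f \<in> Linf M \<Longrightarrow> Linf_norm M f \<le> 1 \<Longrightarrow> Lq_norm q M (T f) \<le> C"
  shows "operator_norm q M T \<le> C"
proof -
  \<comment> \<open>A real supremum can be bounded only over a nonempty set; the zero function lies
    in the unit ball.\<close>
  have "(\<lambda>_. 0) \<in> {f \<in> Linf M. Linf_norm M f \<le> 1}"
    using LinfI[of "\<lambda>_. 0" M 0] by auto
  then show ?thesis
    unfolding operator_norm_def using assms by (intro cSUP_least) auto
qed

text \<open>A real supremum dominates its members only if they are bounded above, which the norm of
  \<open>w\<close> and the bound of \<open>K\<close> ensure on the unit ball.\<close>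

lemma operator_norm_diff_upper:
  assumes q: "1 \<le> q" and w: "w \<in> Lq q M" and K: "bounded_operator q M K"
    and f: "f \<in> Linf M" "Linf_norm M f \<le> 1"
  shows "Lq_norm q M (\<lambda>x. multiplication_operator w f x - K f x)
    \<le> operator_norm q M (\<lambda>f x. multiplication_operator w f x - K f x)"
proof -
  obtain C where C: "\<And>f. f \<in> Linf M \<Longrightarrow> Lq_norm q M (K f) \<le> C * Linf_norm M f"
    using K unfolding bounded_operator_def by blast
  \<comment> \<open>The constant \<open>C\<close> has no prescribed sign, hence its absolute
    value.\<close>
  have "Lq_norm q M (\<lambda>x. multiplication_operator w g x - K g x) \<le> Lq_norm q M w + \<bar>C\<bar>"
    if g: "g \<in> Linf M" "Linf_norm M g \<le> 1" for g
  proof -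
    have "Lq_norm q M (\<lambda>x. multiplication_operator w g x - K g x)
        \<le> Lq_norm q M (multiplication_operator w g) + Lq_norm q M (K g)"
      using K g by (intro Lq_diff q multiplication_operator_Lq w) (auto simp: bounded_operator_def)
    also have "\<dots> \<le> Linf_norm M g * Lq_norm q M w + C * Linf_norm M g"
      by (intro add_mono multiplication_operator_Lq q w g C)
    also have "\<dots> \<le> 1 * Lq_norm q M w + \<bar>C\<bar> * 1"
      using g Linf_norm_nonneg[OF g(1)] by (intro add_mono mult_mono Lq_norm_nonneg) auto
    finally show ?thesis by simp
  qed
  then have "bdd_above ((\<lambda>f. Lq_norm q M (\<lambda>x. multiplication_operator w f x - K f x))
      ` {f \<in> Linf M. Linf_norm M f \<le> 1})"
    by (intro bdd_aboveI2) auto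
  then show ?thesis
    unfolding operator_norm_def using f by (intro cSUP_upper) auto
qed

section \<open>Compactness through constancy on atoms\<close>

section \<open>Multiplication operators on purely atomic spaces\<close>

text \<open>An atom of infinite measure would meet each set of a countable cover by sets of finite
  measure in a null set, and so would itself be null.\<close>

lemma (in sigma_finite_measure) atom_finite:
  assumes "measure_atom M A"
  shows "emeasure M A < \<infinity>"
proof (rule ccontr)
  assume "\<not> emeasure M A < \<infinity>"
  then have inf: "emeasure M A = \<infinity>" by (metis infinity_ennreal_def top.not_eq_extremum)
  obtain F :: "nat \<Rightarrow> 'a set" where F: "range F \<subseteq> sets M" "(\<Union>i. F i) = space M"
    "\<And>i. emeasure M (F i) \<noteq> \<infinity>"
    using sigma_finite by blast
  have A: "A \<in> sets M" using assms by (simp add: measure_atom_def)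
  have "A \<inter> F i \<in> null_sets M" for i
  proof -
    have s: "A \<inter> F i \<in> sets M" using A F(1) by auto
    have "emeasure M (A \<inter> F i) \<le> emeasure M (F i)"
      using F(1) by (intro emeasure_mono) auto
    then have "emeasure M (A \<inter> F i) \<noteq> emeasure M A"
      using F(3)[of i] inf by (auto simp: top_unique)
    then show ?thesis using assms s unfolding measure_atom_def by blast
  qed
  then have "(\<Union>i. A \<inter> F i) \<in> null_sets M" by (intro null_sets_UN)
  moreover have "(\<Union>i. A \<inter> F i) = A"
    using F(2) sets.sets_into_space[OF A] by blast
  ultimately show False using inf by auto
qed

text \<open>For each basic open \<open>U\<close>, either the part of \<open>A\<close> mapped into
  \<open>U\<close> or, by finiteness of the atom, the rest of \<open>A\<close> is null. Outside
  these countably many null sets \<open>N U\<close>, two points of \<open>A\<close> cannot have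
  values separated by a basic open set.\<close>

lemma AE_const_on_atom:
  fixes f :: "'a \<Rightarrow> 'b :: {second_countable_topology, t2_space}"
  assumes atom: "measure_atom M A" "emeasure M A < \<infinity>" and [measurable]: "f \<in> borel_measurable M"
  obtains c where "AE x in M. x \<in> A \<longrightarrow> f x = c"
proof -
  have [measurable]: "A \<in> sets M" using atom by (simp add: measure_atom_def)
  obtain \<B> :: "'b set set" where \<B>: "countable \<B>" "topological_basis \<B>"
    using ex_countable_basis by blast
  define P where "P U = {x \<in> space M. x \<in> A \<and> f x \<in> U}" for U
  define N where "N U = (if emeasure M (P U) = 0 then P U else A - P U)" for U
  have "N U \<in> null_sets M" if "U \<in> \<B>" for U
  proof -
    have [measurable]: "U \<in> sets borel" using topological_basis_open[OF \<B>(2) that] by simp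
    have P: "P U \<in> sets M" unfolding P_def by measurable
    have sub: "P U \<subseteq> A" by (auto simp: P_def)
    show ?thesis
    proof (cases "emeasure M (P U) = 0")
      case True
      then show ?thesis using P by (auto simp: N_def)
    next
      case False
      then have "emeasure M (P U) = emeasure M A"
        using atom(1) P sub unfolding measure_atom_def by blast
      moreover have "emeasure M (A - P U) = emeasure M A - emeasure M (P U)"
        using P sub atom(2) calculation by (intro emeasure_Diff) auto
      ultimately show ?thesis using False P atom(2) by (auto simp: N_def null_sets_def)
    qed
  qed
  then have null: "(\<Union>U\<in>\<B>. N U) \<in> null_sets M"
    using \<B>(1) by (intro null_sets_UN') auto
  have AE: "AE x in M. x \<notin> (\<Union>U\<in>\<B>. N U)" using null by (rule AE_not_in)
  show ?thesis
  proof (cases "A \<subseteq> (\<Union>U\<in>\<B>. N U)")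
    case True
    \<comment> \<open>Here \<open>A\<close> is null, so any constant serves.\<close>
    have "AE x in M. x \<in> A \<longrightarrow> f x = undefined"
      using AE by eventually_elim (use True in blast)
    then show ?thesis by (rule that)
  next
    case False
    then obtain a where a: "a \<in> A" "a \<notin> (\<Union>U\<in>\<B>. N U)" by blast
    have "f x = f a" if x: "x \<in> space M" "x \<in> A" "x \<notin> (\<Union>U\<in>\<B>. N U)" for x
    proof (rule ccontr)
      assume "f x \<noteq> f a"
      then obtain V where V: "open V" "f x \<in> V" "f a \<notin> V"
        by (metis hausdorff disjoint_iff)
      obtain U where U: "U \<in> \<B>" "f x \<in> U" "U \<subseteq> V"
        using topological_basisE[OF \<B>(2) V(1,2)] by blast
      then show False
        using x a V(3) by (auto simp: N_def P_def split: if_splits)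
    qed
    then show ?thesis
      using AE AE_space by (intro that[of "f a"]) auto
  qed
qed

text \<open>Tychonoff's theorem replaces a diagonal argument: the countable product of discs is
  compact and metrizable, hence sequentially compact, and coordinate projections are
  continuous.\<close>

lemma bounded_family_convergent_subsequence:
  fixes c :: "nat \<Rightarrow> nat \<Rightarrow> complex"
  assumes "\<And>n k. cmod (c n k) \<le> C"
  obtains r :: "nat \<Rightarrow> nat" where "strict_mono r" "\<And>k. convergent (\<lambda>n. c (r n) k)"
proof -
  have "compactin (product_topology (\<lambda>_::nat. euclidean) UNIV) (PiE UNIV (\<lambda>_. cball (0::complex) C))"
    by (subst compactin_PiE) (auto simp: compactin_euclidean_iff)
  then have "compact (PiE (UNIV :: nat set) (\<lambda>_. cball (0::complex) C))"
    by (simp add: euclidean_product_topology flip: compactin_euclidean_iff)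
  then have "seq_compact (PiE (UNIV :: nat set) (\<lambda>_. cball (0::complex) C))"
    by (simp add: compact_eq_seq_compact_metric)
  moreover have "\<forall>n. c n \<in> PiE UNIV (\<lambda>_. cball 0 C)"
    using assms by (auto simp: PiE_def)
  ultimately obtain l r where r: "strict_mono r" "(c \<circ> r) \<longlonglongrightarrow> l"
    unfolding seq_compact_def by blast
  have "(\<lambda>n. c (r n) k) \<longlonglongrightarrow> l k" for k
  proof -
    have "continuous_on UNIV (\<lambda>h :: nat \<Rightarrow> complex. h k)"
      by (rule continuous_on_product_coordinates)
    then have "isCont (\<lambda>h :: nat \<Rightarrow> complex. h k) l"
      unfolding continuous_on_eq_continuous_at[OF open_UNIV] by simp
    then show ?thesis using isCont_tendsto_compose r(2) by (fastforce simp: o_def)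
  qed
  then show ?thesis using r(1) by (intro that[of r]) (auto simp: convergent_def)
qed

lemma compact_multiplication_operator_atomic:
  assumes q: "1 \<le> q" and \<sigma>: "sigma_finite_measure M"
    and A: "A \<in> sets M" "purely_atomic_measure (restrict_space M A)"
    and w: "w \<in> Lq q M" "\<And>x. x \<notin> A \<Longrightarrow> w x = 0"
  shows "compact_operator q M (multiplication_operator w)"
  unfolding compact_operator_def
proof (intro conjI allI impI bounded_multiplication_operator[OF q w(1)])
  interpret sigma_finite_measure M by (rule \<sigma>)
  fix f :: "nat \<Rightarrow> 'a \<Rightarrow> complex"
  assume "(\<forall>n. f n \<in> Linf M) \<and> (\<exists>C. \<forall>n. Linf_norm M (f n) \<le> C)"
  then obtain C where f: "\<And>n. f n \<in> Linf M" and C: "\<And>n. Linf_norm M (f n) \<le> C" by blast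
  have C0: "0 \<le> C" using Linf_norm_nonneg[OF f[of 0]] C[of 0] by simp
  have [measurable]: "f n \<in> borel_measurable M" for n using f by (simp add: Linf_def)
  have [measurable]: "w \<in> borel_measurable M"
    and int_w: "integrable M (\<lambda>x. cmod (w x) powr q)"
    using w by (auto simp: Lq_def)
  have bound: "AE x in M. \<forall>n. cmod (f n x) \<le> C"
    unfolding AE_all_countable
  proof
    fix n show "AE x in M. cmod (f n x) \<le> C"
      using Linf_AE_bound[OF f[of n]] by eventually_elim (use C[of n] in simp)
  qed
  obtain \<A> where \<A>: "countable \<A>" "\<forall>B\<in>\<A>. measure_atom (restrict_space M A) B"
    "\<Union>\<A> = space (restrict_space M A)"
    using A(2) unfolding purely_atomic_measure_def by metis
  have A': "A \<inter> space M \<in> sets M" using A by auto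
  have cover: "\<Union>\<A> = A"
    using \<A>(3) sets.sets_into_space[OF A(1)] by (auto simp: space_restrict_space)
  have atom: "measure_atom M B" if "B \<in> \<A>" for B
    using bspec[OF \<A>(2) that] A' unfolding measure_atom_def
    by (auto simp: sets_restrict_space_iff emeasure_restrict_space)
  have "\<exists>c. cmod c \<le> C \<and> (AE x in M. x \<in> B \<longrightarrow> f n x = c)" if B: "B \<in> \<A>" for B n
  proof -
    obtain c where c: "AE x in M. x \<in> B \<longrightarrow> f n x = c"
      using AE_const_on_atom[OF atom[OF B] atom_finite[OF atom[OF B]], of "f n"] by auto
    show ?thesis
    proof (cases "cmod c \<le> C")
      case True
      then show ?thesis using c by blast
    next
      case False
      \<comment> \<open>A constant exceeding the common bound can occur only on a null atom, where
        \<open>0\<close> serves as well.\<close>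
      have "AE x in M. x \<notin> B"
        using c bound by eventually_elim (use False in auto)
      then have "AE x in M. x \<in> B \<longrightarrow> f n x = 0" by eventually_elim simp
      then show ?thesis using C0 by (intro exI[of _ 0]) auto
    qed
  qed
  then obtain c where c: "\<And>B n. B \<in> \<A> \<Longrightarrow> cmod (c B n) \<le> C"
    "\<And>B n. B \<in> \<A> \<Longrightarrow> AE x in M. x \<in> B \<longrightarrow> f n x = c B n"
    by metis
  \<comment> \<open>The atoms are enumerated by natural numbers; the value \<open>0\<close> is taken
    only if the family of atoms is empty.\<close>
  define d where "d n k = (if from_nat_into \<A> k \<in> \<A> then c (from_nat_into \<A> k) n else 0)" for n k
  have "cmod (d n k) \<le> C" for n k using c(1) C0 by (simp add: d_def)
  then obtain r where r: "strict_mono r" "\<And>k. convergent (\<lambda>n. d (r n) k)"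
    using bounded_family_convergent_subsequence[of d C] by blast
  have conv_c: "convergent (\<lambda>n. c B (r n))" if "B \<in> \<A>" for B
    using r(2)[of "to_nat_on \<A> B"] from_nat_into_to_nat_on[OF \<A>(1) that] that by (simp add: d_def)
  have const: "AE x in M. \<forall>B\<in>\<A>. \<forall>n. x \<in> B \<longrightarrow> f n x = c B n"
    unfolding AE_ball_countable[OF \<A>(1)] AE_all_countable using c(2) by blast
  \<comment> \<open>The function \<open>lim\<close> is total, so \<open>g\<close> is measurable
    before convergence is known; convergence is then shown almost everywhere.\<close>
  define g where "g x = lim (\<lambda>n. w x * f (r n) x)" for x
  have g_meas [measurable]: "g \<in> borel_measurable M" unfolding g_def by measurable
  have lim: "AE x in M. (\<lambda>n. w x * f (r n) x) \<longlonglongrightarrow> g x"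
    using const
  proof eventually_elim
    case (elim x)
    have "convergent (\<lambda>n. w x * f (r n) x)"
    proof (cases "x \<in> A")
      case True
      then obtain B where B: "B \<in> \<A>" "x \<in> B" using cover by auto
      then have "(\<lambda>n. w x * f (r n) x) = (\<lambda>n. w x * c B (r n))" using elim by auto
      then show ?thesis using conv_c[OF B(1)] by (auto intro: convergent_mult convergent_const)
    next
      case False
      then show ?thesis using w(2) by (simp add: convergent_const)
    qed
    then show ?case by (simp add: g_def convergent_LIMSEQ_iff)
  qed
  have bound_g: "AE x in M. cmod (g x) \<le> C * cmod (w x)"
    using lim bound
  proof eventually_elim
    case (elim x)
    show ?case
      by (rule tendsto_upperbound[OF tendsto_norm[OF elim(1)]])
        (use elim(2) in \<open>auto simp: norm_mult mult.commute[of C] intro!: always_eventually mult_left_mono\<close>)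
  qed
  have g: "g \<in> Lq q M" by (rule Lq_bounded_AE(1)[OF w(1) g_meas bound_g q C0])
  have "(\<lambda>n. LINT x|M. cmod (w x * f (r n) x - g x) powr q) \<longlonglongrightarrow> (LINT x|M. 0)"
  proof (rule integral_dominated_convergence)
    \<comment> \<open>Both \<open>w x * f (r n) x\<close> and \<open>g x\<close> have modulus at
      most \<open>C * cmod (w x)\<close>, whence the factor \<open>2 * C\<close>.\<close>
    show "integrable M (\<lambda>x. (2 * C) powr q * cmod (w x) powr q)" using int_w by simp
    show "AE x in M. (\<lambda>n. cmod (w x * f (r n) x - g x) powr q) \<longlonglongrightarrow> 0"
      using lim
    proof eventually_elim
      case (elim x)
      then have "(\<lambda>n. cmod (w x * f (r n) x - g x)) \<longlonglongrightarrow> 0"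
        by (simp add: LIM_zero tendsto_norm_zero)
      then show ?case using q by (intro tendsto_zero_powrI[where b = q]) auto
    qed
    show "AE x in M. norm (cmod (w x * f (r n) x - g x) powr q) \<le> (2 * C) powr q * cmod (w x) powr q" for n
      using bound bound_g
    proof eventually_elim
      case (elim x)
      have "cmod (w x * f (r n) x - g x) \<le> cmod (w x) * cmod (f (r n) x) + cmod (g x)"
        using norm_triangle_ineq4[of "w x * f (r n) x" "g x"] by (simp add: norm_mult)
      also have "\<dots> \<le> cmod (w x) * C + C * cmod (w x)"
        using elim by (intro add_mono mult_left_mono) auto
      finally have "cmod (w x * f (r n) x - g x) powr q \<le> (2 * C * cmod (w x)) powr q"
        using q by (intro powr_mono2) (auto simp: algebra_simps)
      then show ?case using C0 by (simp add: powr_mult)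
    qed
  qed measurable
  then have "(\<lambda>n. LINT x|M. cmod (w x * f (r n) x - g x) powr q) \<longlonglongrightarrow> 0" by simp
  then have "(\<lambda>n. (LINT x|M. cmod (w x * f (r n) x - g x) powr q) powr (1 / q)) \<longlonglongrightarrow> 0"
    using q by (intro tendsto_zero_powrI[where b = "1 / q"]) (auto intro!: always_eventually integral_nonneg_AE)
  then show "\<exists>g\<in>Lq q M. \<exists>r. strict_mono r \<and>
      (\<lambda>n. Lq_norm q M (\<lambda>x. multiplication_operator w (f (r n)) x - g x)) \<longlonglongrightarrow> 0"
    using g r(1) by (intro bexI[of _ g] exI[of _ r]) (auto simp: Lq_norm_def multiplication_operator_def)
qed

section \<open>Coin-tossing sets, first for finite measures with halving, then for simple densities
  on the diffuse part\<close>

section \<open>Independent sets in measures without atoms\<close>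

text \<open>The sets behave like independent fair coin tosses, as do the sign sets of the Rademacher
  functions: two of them meet in a quarter of the total mass, so their symmetric difference carries
  half.\<close>

lemma half_measure_sequence:
  assumes fin: "finite_measure N"
    and h: "\<And>A. A \<in> sets N \<Longrightarrow> h A \<in> sets N \<and> h A \<subseteq> A \<and> measure N (h A) = measure N A / 2"
  obtains E :: "nat \<Rightarrow> 'a set" where "range E \<subseteq> sets N"
    "\<And>m n. m \<noteq> n \<Longrightarrow> measure N (sym_diff (E m) (E n)) = measure N (space N) / 2"
proof -
  interpret finite_measure N by (rule fin)
  text \<open>\<open>c n x\<close> is the number whose binary digits tell in which of the first \<open>n\<close> sets \<open>x\<close> lies;
    each set halves every fibre of the preceding code.\<close>
  define F where "F d k = {x \<in> space N. d x = k}" for d :: "'a \<Rightarrow> nat" and k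
  define c where "c = rec_nat (\<lambda>_. 0) (\<lambda>n d x. 2 * d x + of_bool (x \<in> h (F d (d x))))"
  have c0: "c 0 x = 0" and cS: "c (Suc n) x = 2 * c n x + of_bool (x \<in> h (F (c n) (c n x)))" for n x
    by (simp_all add: c_def)
  define E where "E n = {x \<in> space N. odd (c (Suc n) x)}" for n
  have fibre: "F (c n) k \<in> sets N" for n k
  proof (induction n arbitrary: k)
    case 0
    then show ?case by (simp add: F_def c0)
  next
    case (Suc n)
    \<comment> \<open>The last binary digit of a code is the newest membership, and the other digits
      form the preceding code.\<close>
    have "F (c (Suc n)) k = (if odd k then h (F (c n) (k div 2))
        else F (c n) (k div 2) - h (F (c n) (k div 2)))"
    proof -
      have "h (F (c n) (k div 2)) \<subseteq> F (c n) (k div 2)"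
        using h[OF Suc] by blast
      moreover have "(2 * d + of_bool p = k) \<longleftrightarrow> d = k div 2 \<and> (p \<longleftrightarrow> odd k)" for d p
        by (cases p) (simp_all, presburger+)
      ultimately show ?thesis
        unfolding F_def[of "c (Suc n)"] cS by (auto simp: F_def)
    qed
    then show ?case using h[OF Suc] Suc by auto
  qed
  \<comment> \<open>Only finitely many codes occur at level \<open>n\<close>, so finite additivity
    suffices below.\<close>
  have c_less: "c n x < 2 ^ n" for n x
    by (induction n) (auto simp: c0 cS of_bool_def)
  have E_eq: "E n = {x \<in> space N. x \<in> h (F (c n) (c n x))}" for n
    by (auto simp: E_def cS of_bool_def)
  \<comment> \<open>A set described by the first \<open>n\<close> digits is a finite union of
    fibres, each of which \<open>E n\<close> halves.\<close>
  have halves: "{x \<in> space N. P (c n x)} \<in> sets N"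
    "{x \<in> space N. P (c n x)} \<inter> E n \<in> sets N"
    "measure N ({x \<in> space N. P (c n x)} \<inter> E n) = measure N {x \<in> space N. P (c n x)} / 2" for n P
  proof -
    let ?I = "{k. k < 2 ^ n \<and> P k}"
    have I: "finite ?I" by simp
    have S: "{x \<in> space N. P (c n x)} = (\<Union>k\<in>?I. F (c n) k)"
      using c_less by (auto simp: F_def)
    have T: "{x \<in> space N. P (c n x)} \<inter> E n = (\<Union>k\<in>?I. h (F (c n) k))"
      using h[OF fibre[of n]] c_less unfolding E_eq F_def by fastforce
    have d: "disjoint_family_on (F (c n)) ?I"
      unfolding disjoint_family_on_def by (auto simp: F_def)
    have d': "disjoint_family_on (\<lambda>k. h (F (c n) k)) ?I"
      by (rule disjoint_family_on_bisimulation[OF d]) (use h[OF fibre[of n]] in blast)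
    show "{x \<in> space N. P (c n x)} \<in> sets N" "{x \<in> space N. P (c n x)} \<inter> E n \<in> sets N"
      unfolding T unfolding S using fibre h[OF fibre] by auto
    show "measure N ({x \<in> space N. P (c n x)} \<inter> E n) = measure N {x \<in> space N. P (c n x)} / 2"
    proof -
      have "measure N (h (F (c n) k)) = measure N (F (c n) k) / 2" for k
        using h[OF fibre] by blast
      moreover have "(\<lambda>k. h (F (c n) k)) ` ?I \<subseteq> sets N" "F (c n) ` ?I \<subseteq> sets N"
        using fibre h[OF fibre] by auto
      ultimately show ?thesis
        unfolding T unfolding S
        by (simp only: finite_measure_finite_Union[OF I _ d] finite_measure_finite_Union[OF I _ d']
            sum_divide_distrib)
    qed
  qed
  have Es: "E n \<in> sets N" for n
    using halves(2)[where P = "\<lambda>_. True", of n] by (simp add: E_def Int_absorb1)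
  have mE: "measure N (E n) = measure N (space N) / 2" for n
    using halves(3)[where P = "\<lambda>_. True", of n] sets.sets_into_space[OF Es[of n]]
    by (simp add: Int_absorb1)
  \<comment> \<open>Deleting the last \<open>k\<close> digits recovers the earlier code.\<close>
  have shift: "c n x = c (n + k) x div 2 ^ k" for n k x
  proof (induction k)
    case (Suc k)
    have "c (n + Suc k) x div 2 ^ Suc k = (c (Suc (n + k)) x div 2) div 2 ^ k"
      by (simp add: div_mult2_eq)
    also have "c (Suc (n + k)) x div 2 = c (n + k) x"
      by (simp add: cS)
    finally show ?case using Suc by simp
  qed simp
  have less: "measure N (sym_diff (E m) (E n)) = measure N (space N) / 2" if mn: "m < n" for m n
  proof -
    \<comment> \<open>Membership in \<open>E m\<close> is the last digit of the code at level
      \<open>Suc m\<close>, not \<open>m\<close>; since \<open>Suc m \<le> n\<close>, the code at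
      level \<open>n\<close> determines it, and \<open>E n\<close> halves
      \<open>E m\<close>.\<close>
    obtain k where k: "n = Suc m + k"
      using less_imp_Suc_add[OF mn] by auto
    have "c (Suc m) x = c n x div 2 ^ k" for x
      unfolding k by (rule shift)
    then have "E m = {x \<in> space N. odd (c n x div 2 ^ k)}"
      by (simp only: E_def)
    then have i: "measure N (E m \<inter> E n) = measure N (E m) / 2"
      using halves(3)[where P = "\<lambda>j. odd (j div 2 ^ k)", of n] by (simp only:)
    have "measure N (sym_diff (E m) (E n)) = measure N (E m - E n) + measure N (E n - E m)"
      by (rule finite_measure_Union) (auto simp: Es)
    also have "\<dots> = (measure N (E m) - measure N (E m \<inter> E n)) + (measure N (E n) - measure N (E m \<inter> E n))"
      by (simp add: finite_measure_Diff' Es Int_commute)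
    finally show ?thesis using i mE by simp
  qed
  show ?thesis
  proof (rule that[of E])
    show "range E \<subseteq> sets N" using Es by auto
    show "measure N (sym_diff (E m) (E n)) = measure N (space N) / 2" if "m \<noteq> n" for m n
      using less[of m n] less[of n m] that by (cases "m < n") (auto simp: Un_commute)
  qed
qed

lemma diffuse_half:
  assumes D: "D \<in> sets M" "diffuse_measure (restrict_space M D)"
    and A: "A \<in> sets M" "A \<subseteq> D" "emeasure M A < \<infinity>"
  obtains B where "B \<in> sets M" "B \<subseteq> A" "emeasure M B = emeasure M A / 2"
proof (cases "emeasure M A = 0")
  case True
  then show ?thesis using A that[of A] by simp
next
  case False
  have D': "D \<inter> space M \<in> sets M" using D by auto
  obtain r where "emeasure M A = ennreal r" "0 < r"
    using False A(3) by (cases "emeasure M A") (auto simp: less_le)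
  \<comment> \<open>Finiteness of the measure makes the half strictly smaller than the whole, as the
    definition of diffuseness demands.\<close>
  then have "0 < emeasure M A / 2" "emeasure M A / 2 < emeasure M A"
    by (auto simp: ennreal_divide_numeral ennreal_less_iff)
  moreover have "emeasure (restrict_space M D) A = emeasure M A"
    using D' A by (simp add: emeasure_restrict_space)
  moreover have "A \<in> sets (restrict_space M D)"
    using D' A by (simp add: sets_restrict_space_iff)
  ultimately obtain B where "B \<in> sets (restrict_space M D)" "B \<subseteq> A"
    "emeasure (restrict_space M D) B = emeasure M A / 2"
    using D(2) unfolding diffuse_measure_def by metis
  then show ?thesis
    using that[of B] D' A by (auto simp: emeasure_restrict_space sets_restrict_space_iff)
qed

text \<open>On a level set of \<open>s\<close> the weighted measure is a constant multiple of
  \<open>M\<close>, so it suffices to halve the trace of \<open>A\<close> on each of the finitely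
  many nonzero level sets.\<close>

lemma diffuse_simple_density_half:
  assumes D: "D \<in> sets M" "diffuse_measure (restrict_space M D)"
    and s: "simple_function M s" "\<And>x. x \<notin> D \<Longrightarrow> s x = 0" "\<And>x. s x < \<infinity>"
    and fin: "(\<integral>\<^sup>+x. s x \<partial>M) < \<infinity>"
    and A: "A \<in> sets M"
  obtains B where "B \<in> sets M" "B \<subseteq> A" "emeasure (density M s) B = emeasure (density M s) A / 2"
proof -
  define L where "L c = {x \<in> space M. s x = c}" for c
  have [measurable]: "s \<in> borel_measurable M" using s(1) by (rule borel_measurable_simple_function)
  have L: "L c \<in> sets M" for c unfolding L_def by measurable
  \<comment> \<open>The value \<open>0\<close> carries no weight, and its level set need neither
    have finite measure nor lie in \<open>D\<close>.\<close>
  let ?R = "s ` space M - {0}"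
  have R: "finite ?R" using s(1) by (simp add: simple_function_def)
  have half: "\<exists>B. B \<in> sets M \<and> B \<subseteq> A \<inter> L c \<and> emeasure M B = emeasure M (A \<inter> L c) / 2"
    if "c \<in> ?R" for c
  proof -
    \<comment> \<open>Markov's inequality: a nonzero level set of a function with finite integral
      has finite measure.\<close>
    have "c * emeasure M (L c) = (\<integral>\<^sup>+x. c * indicator (L c) x \<partial>M)"
      using L by (simp add: nn_integral_cmult_indicator)
    also have "\<dots> \<le> (\<integral>\<^sup>+x. s x \<partial>M)"
      by (intro nn_integral_mono) (auto simp: L_def indicator_def)
    finally have "c * emeasure M (L c) < \<infinity>" using fin by simp
    then have "emeasure M (L c) < \<infinity>"
      using that by (auto simp: ennreal_mult_less_top)
    then have "emeasure M (A \<inter> L c) < \<infinity>"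
      using emeasure_mono[of "A \<inter> L c" "L c" M] L by (auto intro: le_less_trans)
    moreover have "A \<inter> L c \<subseteq> D"
    proof
      fix x assume "x \<in> A \<inter> L c"
      then have "s x \<noteq> 0" using that by (auto simp: L_def)
      then show "x \<in> D" using s(2) by blast
    qed
    ultimately show ?thesis
      using diffuse_half[OF D, of "A \<inter> L c"] A L by (metis sets.Int)
  qed
  then obtain b where b: "\<And>c. c \<in> ?R \<Longrightarrow> b c \<in> sets M \<and> b c \<subseteq> A \<inter> L c
      \<and> emeasure M (b c) = emeasure M (A \<inter> L c) / 2"
    by metis
  define B where "B = (\<Union>c\<in>?R. b c)"
  have B: "B \<in> sets M" "B \<subseteq> A" using b R unfolding B_def by auto
  have formula: "emeasure (density M s) X = (\<Sum>c\<in>?R. c * emeasure M (X \<inter> L c))" if X: "X \<in> sets M" for X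
  proof -
    have "emeasure (density M s) X = (\<integral>\<^sup>+x. s x * indicator X x \<partial>M)"
      using X by (simp add: emeasure_density)
    also have "\<dots> = (\<integral>\<^sup>+x. (\<Sum>c\<in>?R. c * indicator (X \<inter> L c) x) \<partial>M)"
    proof (intro nn_integral_cong)
      fix x assume x: "x \<in> space M"
      have "(\<Sum>c\<in>?R. c * indicator (X \<inter> L c) x) = (\<Sum>c\<in>?R. if c = s x then c * indicator X x else 0)"
        using x by (intro sum.cong) (auto simp: L_def indicator_def)
      also have "\<dots> = s x * indicator X x"
        using x R by simp
      finally show "s x * indicator X x = (\<Sum>c\<in>?R. c * indicator (X \<inter> L c) x)" by simp
    qed
    also have "\<dots> = (\<Sum>c\<in>?R. c * emeasure M (X \<inter> L c))"
      using X L by (subst nn_integral_sum) (auto simp: nn_integral_cmult_indicator)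
    finally show ?thesis .
  qed
  have "emeasure M (B \<inter> L c) = emeasure M (A \<inter> L c) / 2" if c: "c \<in> ?R" for c
  proof -
    have "B \<inter> L c = b c"
      using b c unfolding B_def L_def by fastforce
    then show ?thesis using b[OF c] by simp
  qed
  then have "emeasure (density M s) B = emeasure (density M s) A / 2"
    unfolding formula[OF B(1)] formula[OF A]
    by (simp add: divide_ennreal_def sum_distrib_right mult.assoc)
  then show ?thesis using that B by blast
qed

text \<open>The measure with density \<open>s\<close> is finite and all its measurable sets can be
  halved, so it admits coin-tossing sets.\<close>

lemma diffuse_simple_density_sequence:
  assumes D: "D \<in> sets M" "diffuse_measure (restrict_space M D)"
    and s: "simple_function M s" "\<And>x. x \<notin> D \<Longrightarrow> s x = 0" "\<And>x. s x < \<infinity>"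
    and fin: "(\<integral>\<^sup>+x. s x \<partial>M) < \<infinity>"
  obtains E :: "nat \<Rightarrow> 'a set" where "range E \<subseteq> sets M"
    "\<And>m n. m \<noteq> n \<Longrightarrow> (\<integral>\<^sup>+x. s x * indicator (sym_diff (E m) (E n)) x \<partial>M) = (\<integral>\<^sup>+x. s x \<partial>M) / 2"
proof -
  have [measurable]: "s \<in> borel_measurable M" using s(1) by (rule borel_measurable_simple_function)
  let ?N = "density M s"
  have sp: "emeasure ?N (space M) = (\<integral>\<^sup>+x. s x \<partial>M)"
    by (simp add: emeasure_density cong: nn_integral_cong)
  interpret finite_measure ?N
    by (rule finite_measureI) (use fin sp in simp)
  have "\<exists>B. B \<in> sets M \<and> B \<subseteq> A \<and> emeasure ?N B = emeasure ?N A / 2" if "A \<in> sets M" for A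
    by (rule diffuse_simple_density_half[OF D s(1) _ s(3) fin that]) (use s(2) in blast)+
  then obtain h where h: "\<And>A. A \<in> sets M \<Longrightarrow> h A \<in> sets M \<and> h A \<subseteq> A \<and> emeasure ?N (h A) = emeasure ?N A / 2"
    by metis
  note h
  moreover have half: "measure ?N X = measure ?N Y / 2 \<longleftrightarrow> emeasure ?N X = emeasure ?N Y / 2" for X Y
    by (simp add: emeasure_eq_measure ennreal_divide_numeral)
  ultimately have "A \<in> sets ?N \<Longrightarrow> h A \<in> sets ?N \<and> h A \<subseteq> A \<and> measure ?N (h A) = measure ?N A / 2" for A
    unfolding half by simp
  from half_measure_sequence[OF finite_measure_axioms this]
  obtain E :: "nat \<Rightarrow> 'a set" where E: "range E \<subseteq> sets ?N"
    "\<And>m n. m \<noteq> n \<Longrightarrow> measure ?N (sym_diff (E m) (E n)) = measure ?N (space ?N) / 2"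
    by blast
  show ?thesis
  proof (rule that[of E])
    show "range E \<subseteq> sets M" using E by simp
    fix m n :: nat assume "m \<noteq> n"
    then have "emeasure ?N (sym_diff (E m) (E n)) = emeasure ?N (space M) / 2"
      using E(2)[of m n] unfolding half by simp
    moreover have "sym_diff (E m) (E n) \<in> sets M" using E(1) by auto
    ultimately show "(\<integral>\<^sup>+x. s x * indicator (sym_diff (E m) (E n)) x \<partial>M) = (\<integral>\<^sup>+x. s x \<partial>M) / 2"
      by (simp add: sp emeasure_density)
  qed
qed

section \<open>Testing against compact operators with differences of indicators\<close>

section \<open>The lower bound\<close>

lemma Linf_indicator_diff:
  assumes [measurable]: "A \<in> sets M" "B \<in> sets M"
  shows "(\<lambda>x. indicator A x - indicator B x :: complex) \<in> Linf M"
    and "Linf_norm M (\<lambda>x. indicator A x - indicator B x :: complex) \<le> 1"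
proof -
  have "AE x in M. cmod (indicator A x - indicator B x) \<le> 1"
    by (auto simp: indicator_def)
  then show "(\<lambda>x. indicator A x - indicator B x :: complex) \<in> Linf M"
    "Linf_norm M (\<lambda>x. indicator A x - indicator B x :: complex) \<le> 1"
    using LinfI[of "\<lambda>x. indicator A x - indicator B x :: complex" M 1] by auto
qed

text \<open>Two late terms of a convergent subsequence of images lie within \<open>e / 2\<close> of
  the limit, and linearity almost everywhere moves their difference inside \<open>K\<close>.\<close>

lemma compact_operator_almost_repeats:
  assumes q: "1 \<le> q" and K: "compact_operator q M K"
    and f: "\<And>n. f n \<in> Linf M" "\<And>n. Linf_norm M (f n) \<le> C"
    and d: "\<And>m n. (\<lambda>x. f m x - f n x) \<in> Linf M" and e: "0 < e"
  obtains m n :: nat where "m \<noteq> n" "Lq_norm q M (K (\<lambda>x. f m x - f n x)) < e"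
proof -
  have bo: "bounded_operator q M K" using K by (simp add: compact_operator_def)
  have KL: "K h \<in> Lq q M" if "h \<in> Linf M" for h
    using bo that by (simp add: bounded_operator_def)
  obtain g r where g: "g \<in> Lq q M" and r: "strict_mono r"
    and lim: "(\<lambda>n. Lq_norm q M (\<lambda>x. K (f (r n)) x - g x)) \<longlonglongrightarrow> 0"
    using K f unfolding compact_operator_def by meson
  have "\<forall>\<^sub>F n in sequentially. Lq_norm q M (\<lambda>x. K (f (r n)) x - g x) < e / 2"
    using order_tendstoD(2)[OF lim, of "e / 2"] e by simp
  then obtain n where n: "\<And>m. m \<ge> n \<Longrightarrow> Lq_norm q M (\<lambda>x. K (f (r m)) x - g x) < e / 2"
    by (auto simp: eventually_sequentially)
  let ?a = "r n" and ?b = "r (Suc n)"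
  have ne: "?a \<noteq> ?b" using strict_monoD[OF r, of n "Suc n"] by simp
  have "AE x in M. K (\<lambda>y. 1 * f ?a y + (-1) * f ?b y) x = 1 * K (f ?a) x + (-1) * K (f ?b) x"
    using bo f unfolding bounded_operator_def by blast
  then have "AE x in M. K (\<lambda>y. f ?a y - f ?b y) x = (K (f ?a) x - g x) - (K (f ?b) x - g x)"
    by simp
  moreover have "K (\<lambda>y. f ?a y - f ?b y) \<in> borel_measurable M"
    "(\<lambda>x. (K (f ?a) x - g x) - (K (f ?b) x - g x)) \<in> borel_measurable M"
    using KL[OF d] Lq_diff(1)[OF q Lq_diff(1)[OF q KL[OF f(1)] g] Lq_diff(1)[OF q KL[OF f(1)] g]]
    by (auto simp: Lq_def)
  ultimately have "Lq_norm q M (K (\<lambda>y. f ?a y - f ?b y))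
      = Lq_norm q M (\<lambda>x. (K (f ?a) x - g x) - (K (f ?b) x - g x))"
    by (intro Lq_norm_cong_AE)
  also have "\<dots> \<le> Lq_norm q M (\<lambda>x. K (f ?a) x - g x) + Lq_norm q M (\<lambda>x. K (f ?b) x - g x)"
    by (intro Lq_diff(2) q Lq_diff(1) KL f g)
  also have "\<dots> < e"
    using n[of n] n[of "Suc n"] by simp
  finally show ?thesis using ne that by blast
qed

lemma operator_norm_multiplication_minus_compact:
  assumes q: "1 \<le> q" and D: "D \<in> sets M" "diffuse_measure (restrict_space M D)"
    and u: "u \<in> Lq q M" and K: "compact_operator q M K"
  shows "1 / 2 * (LINT x:D|M. cmod (u x) powr q) powr (1 / q)
    \<le> operator_norm q M (\<lambda>f x. multiplication_operator u f x - K f x)" (is "_ \<le> ?T")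
proof -
  have [measurable]: "u \<in> borel_measurable M" "D \<in> sets M"
    and int_u: "integrable M (\<lambda>x. cmod (u x) powr q)"
    using u D by (auto simp: Lq_def)
  have bo: "bounded_operator q M K" using K by (simp add: compact_operator_def)
  define v where "v x = indicator D x * cmod (u x) powr q" for x
  have [measurable]: "v \<in> borel_measurable M" unfolding v_def by measurable
  have v0: "0 \<le> v x" for x by (simp add: v_def)
  have int_v: "integrable M v"
    by (rule Bochner_Integration.integrable_bound[OF int_u]) (auto simp: v_def indicator_def)
  \<comment> \<open>Nonnegativity is needed to recover \<open>?T\<close> from
    \<open>?T powr q\<close>.\<close>
  have T0: "0 \<le> ?T"
    using operator_norm_diff_upper[OF q u bo, of "\<lambda>_. 0"] LinfI[of "\<lambda>_. 0" M 0]
    by (auto intro: order_trans[OF Lq_norm_nonneg])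
  have key: "(\<integral>\<^sup>+x. s x \<partial>M) / 2 \<le> ennreal (?T powr q)"
    if s: "simple_function M s" "s \<le> (\<lambda>x. ennreal (v x))" "\<forall>x. s x < top" for s
  proof -
    have sD: "s x = 0" if "x \<notin> D" for x
      using le_funD[OF s(2), of x] that by (simp add: v_def)
    have "(\<integral>\<^sup>+x. s x \<partial>M) \<le> (\<integral>\<^sup>+x. v x \<partial>M)"
      using s(2) by (intro nn_integral_mono) (auto simp: le_fun_def)
    then have fin: "(\<integral>\<^sup>+x. s x \<partial>M) < \<infinity>"
      using int_v v0 by (auto simp: nn_integral_eq_integral intro: le_less_trans)
    obtain E :: "nat \<Rightarrow> 'a set" where E: "range E \<subseteq> sets M"
      "\<And>m n. m \<noteq> n \<Longrightarrow> (\<integral>\<^sup>+x. s x * indicator (sym_diff (E m) (E n)) x \<partial>M) = (\<integral>\<^sup>+x. s x \<partial>M) / 2"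
      using diffuse_simple_density_sequence[OF D s(1) _ _ fin] sD s(3) by (metis infinity_ennreal_def)
    have Es [measurable]: "E n \<in> sets M" for n using E(1) by auto
    have f: "(\<lambda>x. indicator (E n) x :: complex) \<in> Linf M"
      "Linf_norm M (\<lambda>x. indicator (E n) x :: complex) \<le> 1" for n
      using Linf_indicator_diff[OF Es[of n] sets.empty_sets] by auto
    \<comment> \<open>The slack \<open>e\<close> absorbs the image under \<open>K\<close> of the
      test function.\<close>
    have bnd: "(\<integral>\<^sup>+x. s x \<partial>M) / 2 \<le> ennreal ((?T + e) powr q)" if e: "0 < e" for e
    proof -
      obtain m n where mn: "m \<noteq> n"
        "Lq_norm q M (K (\<lambda>x. indicator (E m) x - indicator (E n) x)) < e"
        by (rule compact_operator_almost_repeats[where f = "\<lambda>n x. indicator (E n) x",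
              OF q K f Linf_indicator_diff(1)[OF Es Es] e])
      let ?f = "\<lambda>x. indicator (E m) x - indicator (E n) x :: complex"
      let ?w = "multiplication_operator u ?f"
      have L: "?f \<in> Linf M" "Linf_norm M ?f \<le> 1" by (rule Linf_indicator_diff[OF Es Es])+
      have w: "?w \<in> Lq q M" by (rule multiplication_operator_Lq(1)[OF q u L(1)])
      have Kf: "K ?f \<in> Lq q M" using bo L(1) by (simp add: bounded_operator_def)
      have "Lq_norm q M ?w = Lq_norm q M (\<lambda>x. (?w x - K ?f x) + K ?f x)" by simp
      also have "\<dots> \<le> Lq_norm q M (\<lambda>x. ?w x - K ?f x) + Lq_norm q M (K ?f)"
        by (intro Lq_norm_minkowski(2) q Lq_diff(1) w Kf)
      also have "\<dots> \<le> ?T + e"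
        using operator_norm_diff_upper[OF q u bo L] mn(2) by simp
      finally have "Lq_norm q M ?w powr q \<le> (?T + e) powr q"
        using q Lq_norm_nonneg[of q M ?w] by (intro powr_mono2) auto
      then have le: "(LINT x|M. cmod (?w x) powr q) \<le> (?T + e) powr q"
        using q by (simp add: Lq_norm_powr)
      have "(\<integral>\<^sup>+x. s x \<partial>M) / 2 = (\<integral>\<^sup>+x. s x * indicator (sym_diff (E m) (E n)) x \<partial>M)"
        using E(2)[OF mn(1)] by simp
      also have "\<dots> \<le> (\<integral>\<^sup>+x. ennreal (cmod (?w x) powr q) \<partial>M)"
      proof (rule nn_integral_mono)
        fix x
        have "s x \<le> ennreal (cmod (u x) powr q)"
          using le_funD[OF s(2), of x] by (cases "x \<in> D") (auto simp: v_def)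
        \<comment> \<open>On the symmetric difference the test function is \<open>1\<close> or
          \<open>-1\<close>, so the product has the modulus of \<open>u\<close> there.\<close>
        then show "s x * indicator (sym_diff (E m) (E n)) x \<le> ennreal (cmod (?w x) powr q)"
          by (auto simp: multiplication_operator_def indicator_def)
      qed
      also have "\<dots> = ennreal (LINT x|M. cmod (?w x) powr q)"
        using w by (intro nn_integral_eq_integral) (auto simp: Lq_def)
      also have "\<dots> \<le> ennreal ((?T + e) powr q)" using le by (rule ennreal_leI)
      finally show ?thesis .
    qed
    have "((\<lambda>e. ennreal ((?T + e) powr q)) \<longlongrightarrow> ennreal ((?T + 0) powr q)) (at_right 0)"
      using q T0 by (intro tendsto_ennrealI tendsto_powr' tendsto_intros)
        (auto simp: eventually_at_right_less intro!: eventually_at_rightI[of 0 1])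
    then have "((\<lambda>e. ennreal ((?T + e) powr q)) \<longlongrightarrow> ennreal (?T powr q)) (at_right 0)" by simp
    then show ?thesis
      by (rule tendsto_lowerbound)
        (use bnd in \<open>auto intro!: eventually_at_rightI[of 0 1]\<close>)
  qed
  have "ennreal (LINT x|M. v x) = (\<integral>\<^sup>+x. v x \<partial>M)"
    using int_v v0 by (simp add: nn_integral_eq_integral)
  also have "\<dots> \<le> ennreal (2 * ?T powr q)"
    \<comment> \<open>The integral is the supremum over finite-valued simple minorants of
      \<open>v\<close>, to each of which \<open>key\<close> applies.\<close>
    unfolding nn_integral_def_finite
  proof (rule SUP_least)
    fix s assume s: "s \<in> {g. simple_function M g \<and> g \<le> (\<lambda>x. ennreal (v x)) \<and> (\<forall>x. g x < top)}"
    then have "(\<integral>\<^sup>+x. s x \<partial>M) / 2 * 2 \<le> ennreal (?T powr q) * 2"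
      by (intro mult_right_mono key) auto
    moreover have "X / 2 * 2 = X" for X :: ennreal
      using mult_divide_eq_ennreal[of 2 X] by (simp add: ennreal_times_divide mult.commute)
    ultimately show "integral\<^sup>S M s \<le> ennreal (2 * ?T powr q)"
      using s by (simp add: nn_integral_eq_simple_integral ennreal_mult mult.commute)
  qed
  finally have "(LINT x|M. v x) \<le> 2 * ?T powr q"
    by (subst (asm) ennreal_le_iff) auto
  then have "(LINT x|M. v x) powr (1 / q) \<le> (2 * ?T powr q) powr (1 / q)"
    using q v0 by (intro powr_mono2) auto
  also have "\<dots> = 2 powr (1 / q) * ?T"
    using q T0 by (simp add: powr_mult powr_powr)
  \<comment> \<open>The sharper factor \<open>2 powr (1 / q)\<close> is relaxed to \<open>2\<close>,
    using \<open>1 \<le> q\<close>.\<close>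
  also have "\<dots> \<le> 2 powr 1 * ?T"
    using q T0 by (intro mult_right_mono powr_mono) auto
  finally show ?thesis
    by (simp add: v_def set_lebesgue_integral_def)
qed

section \<open>Both bounds together, with multiplication on the atomic part as the compact
  competitor\<close>

theorem theorem1p4:
  fixes M :: "'a measure" and \<Omega>d \<Omega>a :: "'a set" and q :: real and u :: "'a \<Rightarrow> complex"
  assumes "1 \<le> q"
    and "sigma_finite_measure M"
    and "separable_measure M"
    and "diffuse_atomic_decomposition M \<Omega>d \<Omega>a"
    and "u \<in> Lq q M"
  shows "1 / 2 * (LINT x:\<Omega>d|M. cmod (u x) powr q) powr (1 / q)
           \<le> essential_norm q M (multiplication_operator u)
       \<and> essential_norm q M (multiplication_operator u)
           \<le> (LINT x:\<Omega>d|M. cmod (u x) powr q) powr (1 / q)"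
  proof -
  have q: "1 \<le> q" by fact
  have u: "u \<in> Lq q M" by fact
  have D: "\<Omega>d \<in> sets M" "diffuse_measure (restrict_space M \<Omega>d)"
    and A: "\<Omega>a \<in> sets M" "purely_atomic_measure (restrict_space M \<Omega>a)"
    and DA: "\<Omega>d \<inter> \<Omega>a = {}" "\<Omega>d \<union> \<Omega>a = space M"
    using assms(4) by (auto simp: diffuse_atomic_decomposition_def)
  have [measurable]: "u \<in> borel_measurable M" "\<Omega>d \<in> sets M" "\<Omega>a \<in> sets M"
    using u D A by (auto simp: Lq_def)
  let ?S = "(LINT x:\<Omega>d|M. cmod (u x) powr q) powr (1 / q)"
  let ?M = "multiplication_operator u"
  let ?T = "\<lambda>K f x. ?M f x - K f x"
  \<comment> \<open>On the whole space \<open>u\<close> is \<open>w + z\<close>: \<open>w\<close>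
    yields the compact operator, and \<open>z\<close> is the remainder, whose norm is
    \<open>?S\<close>.\<close>
  define w where "w x = (if x \<in> \<Omega>a then u x else 0)" for x
  define z where "z x = (if x \<in> \<Omega>d then u x else 0)" for x
  have [measurable]: "w \<in> borel_measurable M" "z \<in> borel_measurable M"
    unfolding w_def z_def by measurable
  have w: "w \<in> Lq q M"
    by (rule Lq_bounded_AE(1)[OF u, of w 1]) (use q in \<open>auto simp: w_def\<close>)
  have z: "z \<in> Lq q M"
    by (rule Lq_bounded_AE(1)[OF u, of z 1]) (use q in \<open>auto simp: z_def\<close>)
  have "(LINT x|M. cmod (z x) powr q) = (LINT x:\<Omega>d|M. cmod (u x) powr q)"
    unfolding set_lebesgue_integral_def
    by (intro Bochner_Integration.integral_cong) (auto simp: z_def)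
  then have norm_z: "Lq_norm q M z = ?S" by (simp add: Lq_norm_def)
  have compact: "compact_operator q M (multiplication_operator w)"
    by (rule compact_multiplication_operator_atomic[OF q assms(2) A w]) (simp add: w_def)
  have lower: "1 / 2 * ?S \<le> operator_norm q M (?T K)" if "compact_operator q M K" for K
    by (rule operator_norm_multiplication_minus_compact[OF q D u that])
  \<comment> \<open>The real infimum must range over a nonempty set; multiplication by
    \<open>w\<close> is a member.\<close>
  have "1 / 2 * ?S \<le> essential_norm q M ?M"
    unfolding essential_norm_def using compact lower by (intro cINF_greatest) auto
  \<comment> \<open>The infimum lies below this member because \<open>lower\<close> bounds the whole
    set from below.\<close>
  moreover have "essential_norm q M ?M \<le> operator_norm q M (?T (multiplication_operator w))"
    unfolding essential_norm_def
    by (rule cINF_lower) (use compact lower in \<open>auto intro: bdd_belowI2[where m = "1 / 2 * ?S"]\<close>)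
  moreover have "operator_norm q M (?T (multiplication_operator w)) \<le> ?S"
  proof (rule operator_norm_le)
    fix f assume f: "f \<in> Linf M" "Linf_norm M f \<le> 1"
    then have [measurable]: "f \<in> borel_measurable M" by (simp add: Linf_def)
    have "Lq_norm q M (?T (multiplication_operator w) f) = Lq_norm q M (multiplication_operator z f)"
      by (intro Lq_norm_cong_AE AE_I2)
        (use DA in \<open>auto simp: multiplication_operator_def w_def z_def\<close>)
    also have "\<dots> \<le> Linf_norm M f * Lq_norm q M z"
      by (rule multiplication_operator_Lq(2)[OF q z f(1)])
    also have "\<dots> \<le> ?S"
      using mult_right_mono[OF f(2) Lq_norm_nonneg[of q M z]] by (simp add: norm_z)
    finally show "Lq_norm q M (?T (multiplication_operator w) f) \<le> ?S" .
  qed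
  ultimately show ?thesis by linarith
qed

end
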